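(* Consider the Diophantine equation $xyz = w^2$ in positive integers $x, y, z, w$. A quadruple $(x,y,z,w)$ of positive integers is a solution of this equation if and only if there exist positive integers $d, r_1, r_2, t, u_1, u_2$ with $\gcd(r_1,r_2)=1$, $\gcd(u_1,u_2)=1$ and $\gcd(t, r_1 r_2)=1$ such that $$x = d\, r_1^2 u_1,\qquad y = d\, r_2^2 u_2,\qquad z = t^2 u_1 u_2,\qquad w = d\, r_1 r_2\, t\, u_1 u_2 .$$ *)

theory Defs
  imports Main
begin

end

(* Split off d = gcd x y, then u\<^sub>1 = gcd (x/d) z and u\<^sub>2 = gcd (y/d) z, which are coprime. The
   product of the three remaining cofactors of x, y, z is x * y * z / (d u\<^sub>1 u\<^sub>2)\<^sup>2, hence a square,
   and the cofactors are pairwise coprime, hence squares themselves. *)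

theory Submission
  imports Defs "HOL-Computational_Algebra.Nth_Powers"
begin

text \<open>Carries the number theory of the forward direction. Positivity of the parameters is left
  to the theorem, where it can be read off from \<open>w\<close>.\<close>

lemma square_decomposition:
  fixes x y z w :: nat
  assumes pos: "x > 0" "y > 0" "z > 0" and eq: "x * y * z = w ^ 2"
  obtains d r\<^sub>1 r\<^sub>2 t u\<^sub>1 u\<^sub>2 :: nat where
    "coprime r\<^sub>1 r\<^sub>2" "coprime u\<^sub>1 u\<^sub>2" "coprime t (r\<^sub>1 * r\<^sub>2)"
    "x = d * r\<^sub>1 ^ 2 * u\<^sub>1" "y = d * r\<^sub>2 ^ 2 * u\<^sub>2" "z = t ^ 2 * u\<^sub>1 * u\<^sub>2"
    "w = d * r\<^sub>1 * r\<^sub>2 * t * u\<^sub>1 * u\<^sub>2"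
proof -
  define d where "d = gcd x y"
  obtain a b where ab: "x = a * d" "y = b * d" "coprime a b"
    using gcd_coprime_exists[of x y] pos(1) unfolding d_def by (metis gcd_eq_0_iff less_irrefl)
  define u\<^sub>1 where "u\<^sub>1 = gcd a z"
  define u\<^sub>2 where "u\<^sub>2 = gcd b z"
  obtain a' z\<^sub>1 where a': "a = a' * u\<^sub>1" "z = z\<^sub>1 * u\<^sub>1" "coprime a' z\<^sub>1"
    using gcd_coprime_exists[of a z] pos(3) unfolding u\<^sub>1_def by (metis gcd_eq_0_iff less_irrefl)
  obtain b' z\<^sub>2 where b': "b = b' * u\<^sub>2" "z = z\<^sub>2 * u\<^sub>2" "coprime b' z\<^sub>2"
    using gcd_coprime_exists[of b z] pos(3) unfolding u\<^sub>2_def by (metis gcd_eq_0_iff less_irrefl)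
  \<comment> \<open>Divisors of the coprime numbers \<open>a\<close> and \<open>b\<close> are again
    coprime. In particular \<open>u\<^sub>1\<close> and \<open>u\<^sub>2\<close> are coprime
    divisors of \<open>z\<close>, so their product divides \<open>z\<close>.\<close>
  have cop: "coprime a' b'" "coprime u\<^sub>1 u\<^sub>2"
    using ab(3) unfolding a'(1) b'(1) by simp_all
  then have "u\<^sub>1 * u\<^sub>2 dvd z"
    by (simp add: divides_mult u\<^sub>1_def u\<^sub>2_def)
  then obtain c where c: "z = c * u\<^sub>1 * u\<^sub>2"
    by (metis dvd_def mult.assoc mult.commute)
  have nz: "d > 0" "u\<^sub>1 > 0" "u\<^sub>2 > 0" "a' > 0" "b' > 0" "c > 0"
    using pos unfolding ab(1,2) a'(1) b'(1) c by simp_all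
  \<comment> \<open>Comparing factorizations of \<open>z\<close> shows that \<open>c\<close> divides
    both \<open>z\<^sub>1\<close> and \<open>z\<^sub>2\<close>, so it inherits their coprimality to
    \<open>a'\<close> and \<open>b'\<close> respectively.\<close>
  have "z\<^sub>1 * u\<^sub>1 = c * u\<^sub>2 * u\<^sub>1" "z\<^sub>2 * u\<^sub>2 = c * u\<^sub>1 * u\<^sub>2"
    using a'(2) b'(2) c by (simp_all only: mult_ac)
  then have "z\<^sub>1 = c * u\<^sub>2" "z\<^sub>2 = c * u\<^sub>1"
    using nz by simp_all
  then have cop': "coprime a' c" "coprime b' c"
    using a'(3) b'(3) by simp_all
  \<comment> \<open>Each of \<open>d\<close>, \<open>u\<^sub>1\<close>, \<open>u\<^sub>2\<close>
    divides out of exactly two of \<open>x = a' * u\<^sub>1 * d\<close>,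
    \<open>y = b' * u\<^sub>2 * d\<close> and \<open>z = c * u\<^sub>1 * u\<^sub>2\<close>.
    Cancelling this nonzero square leaves \<open>a' * b' * c\<close> a square.\<close>
  have "(d * u\<^sub>1 * u\<^sub>2) ^ 2 * (a' * b' * c) = w ^ 2"
    using eq unfolding ab a'(1) b'(1) c by (simp add: power2_eq_square mult_ac)
  then have "is_nth_power 2 ((d * u\<^sub>1 * u\<^sub>2) ^ 2 * (a' * b' * c))"
    by simp
  then have "is_nth_power 2 (a' * b' * c)"
    using nz by (subst (asm) is_nth_power_mult_cancel_left) auto
  then have "is_nth_power 2 a'" "is_nth_power 2 b'" "is_nth_power 2 c"
    using cop cop' by (simp_all add: is_nth_power_mult_coprime_nat_iff)
  then obtain r\<^sub>1 r\<^sub>2 t where r: "a' = r\<^sub>1 ^ 2" "b' = r\<^sub>2 ^ 2" "c = t ^ 2"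
    unfolding is_nth_power_def by blast
  have "w ^ 2 = (d * r\<^sub>1 * r\<^sub>2 * t * u\<^sub>1 * u\<^sub>2) ^ 2"
    using eq unfolding ab a'(1) b'(1) c r by (simp add: power2_eq_square mult_ac)
  then have "w = d * r\<^sub>1 * r\<^sub>2 * t * u\<^sub>1 * u\<^sub>2"
    by simp
  \<comment> \<open>Coprimality of the squares \<open>a'\<close>, \<open>b'\<close>,
    \<open>c\<close> passes to their roots \<open>r\<^sub>1\<close>, \<open>r\<^sub>2\<close>,
    \<open>t\<close>. Since \<open>t\<close> is coprime to each of the other two, it is coprime to
    their product.\<close>
  with cop cop' show thesis
    by (intro that[of r\<^sub>1 r\<^sub>2 u\<^sub>1 u\<^sub>2 t d])
      (simp_all add: ab a'(1) b'(1) c r mult_ac coprime_commute)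
qed

theorem theorem7:
  fixes x y z w :: nat
  assumes "x > 0" and "y > 0" and "z > 0" and "w > 0"
  shows "x * y * z = w ^ 2 \<longleftrightarrow>
    (\<exists>d r\<^sub>1 r\<^sub>2 t u\<^sub>1 u\<^sub>2 :: nat.
       d > 0 \<and> r\<^sub>1 > 0 \<and> r\<^sub>2 > 0 \<and> t > 0 \<and> u\<^sub>1 > 0 \<and> u\<^sub>2 > 0 \<and>
       gcd r\<^sub>1 r\<^sub>2 = 1 \<and> gcd u\<^sub>1 u\<^sub>2 = 1 \<and> gcd t (r\<^sub>1 * r\<^sub>2) = 1 \<and>
       x = d * r\<^sub>1 ^ 2 * u\<^sub>1 \<and>
       y = d * r\<^sub>2 ^ 2 * u\<^sub>2 \<and>
       z = t ^ 2 * u\<^sub>1 * u\<^sub>2 \<and>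
       w = d * r\<^sub>1 * r\<^sub>2 * t * u\<^sub>1 * u\<^sub>2)"
    (is "_ \<longleftrightarrow> ?rhs")
proof
  assume "x * y * z = w ^ 2"
  with assms(1-3) obtain d r\<^sub>1 r\<^sub>2 t u\<^sub>1 u\<^sub>2 :: nat where
    cop: "coprime r\<^sub>1 r\<^sub>2" "coprime u\<^sub>1 u\<^sub>2" "coprime t (r\<^sub>1 * r\<^sub>2)" and
    eqs: "x = d * r\<^sub>1 ^ 2 * u\<^sub>1" "y = d * r\<^sub>2 ^ 2 * u\<^sub>2" "z = t ^ 2 * u\<^sub>1 * u\<^sub>2"
      "w = d * r\<^sub>1 * r\<^sub>2 * t * u\<^sub>1 * u\<^sub>2"
    by (rule square_decomposition)
  \<comment> \<open>All six parameters are factors of \<open>w\<close>, which is positive.\<close>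
  have "d > 0" "r\<^sub>1 > 0" "r\<^sub>2 > 0" "t > 0" "u\<^sub>1 > 0" "u\<^sub>2 > 0"
    using assms(4) unfolding eqs(4) by simp_all
  with cop eqs show ?rhs
    unfolding coprime_iff_gcd_eq_1
    by (intro exI[of _ d] exI[of _ r\<^sub>1] exI[of _ r\<^sub>2] exI[of _ t] exI[of _ u\<^sub>1] exI[of _ u\<^sub>2] conjI)
next
  assume ?rhs
  then obtain d r\<^sub>1 r\<^sub>2 t u\<^sub>1 u\<^sub>2 where
    "x = d * r\<^sub>1 ^ 2 * u\<^sub>1" "y = d * r\<^sub>2 ^ 2 * u\<^sub>2" "z = t ^ 2 * u\<^sub>1 * u\<^sub>2"
    "w = d * r\<^sub>1 * r\<^sub>2 * t * u\<^sub>1 * u\<^sub>2"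
    by (elim exE conjE)
  \<comment> \<open>Every parameter occurs in \<open>x * y * z\<close> with total exponent two and
    in \<open>w\<close> with exponent one.\<close>
  then show "x * y * z = w ^ 2"
    by (simp add: power2_eq_square mult_ac)
qed

end
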